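(* Let $G$ be a finite group, $H$ a subgroup, and $S\subseteq G\setminus H$ a set of representatives of pairwise distinct double cosets $HsH$ with $\langle H,S\rangle=G$, and suppose $\mathcal{G}=\mathcal{G}(G,H,S)$ is not complete. Let $R_1,R_2$ be a partition of $S$ such that the group $G'=\langle H,R_1\rangle$ contains no element of $R_2$, and let $\mathcal{G}'=\mathcal{G}(G',H,R_1)$. Suppose that whenever $r,s\in R_2$ satisfy $G'rG'=G'sG'$, we have $\langle H,r\rangle=\langle H,s\rangle$. Then $$\kappa(\mathcal{G})\geq\min\big(|V(\mathcal{G}')|,\ \kappa(\mathcal{G}')+d_{R_2}\big).$$
   Context: The Cayley coset digraph $\mathcal{G}(K,H,T)$ (for a group $K$, subgroup $H$, $T\subseteq K\setminus H$) has vertex set $K/H$ of left cosets of $H$ in $K$, and $(gH,g'H)$ is an edge iff $gHt\cap g'H\neq\emptyset$ for some $t\in T$. For $s\in S$, $d_s=|HsH/H|$ is the number of left cosets of $H$ contained in $HsH$, and $d_{R}=\sum_{s\in R}d_s$. $\kappa(\Gamma)$ denotes the vertex connectivity: the smallest number of vertices whose removal leaves a digraph that is not strongly connected (for a complete digraph on $m$ vertices it is $m-1$). A digraph is complete if every ordered pair of distinct vertices is an edge. *)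

theory Defs
  imports
    "HOL-Algebra.Left_Coset"
    "HOL-Algebra.Generated_Groups"
    "Graph_Theory.Digraph_Component"
begin

definition double_coset :: "('a, 'm) monoid_scheme \<Rightarrow> 'a set \<Rightarrow> 'a \<Rightarrow> 'a set" where
  "double_coset G H s = (H #>\<^bsub>G\<^esub> s) <#>\<^bsub>G\<^esub> H"

text \<open>The vertices are themselves cosets, so an edge \<open>(A, B)\<close> with \<open>A = gH\<close> and \<open>B = g'H\<close> is
  expressed by \<open>At \<inter> B \<noteq> {}\<close>, without choosing representatives.\<close>

definition cayley_coset_digraph ::
    "('a, 'm) monoid_scheme \<Rightarrow> 'a set \<Rightarrow> 'a set \<Rightarrow> 'a set pair_pre_digraph" where
  "cayley_coset_digraph K H T =
     \<lparr> pverts = lcosets\<^bsub>K\<^esub> H,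
       parcs = {(A, B). A \<in> lcosets\<^bsub>K\<^esub> H \<and> B \<in> lcosets\<^bsub>K\<^esub> H \<and>
                        (\<exists>t\<in>T. (A #>\<^bsub>K\<^esub> t) \<inter> B \<noteq> {})} \<rparr>"

definition coset_degree :: "('a, 'm) monoid_scheme \<Rightarrow> 'a set \<Rightarrow> 'a \<Rightarrow> nat" where
  "coset_degree G H s = card {C \<in> lcosets\<^bsub>G\<^esub> H. C \<subseteq> double_coset G H s}"

definition is_complete :: "('a, 'b) pre_digraph \<Rightarrow> bool" where
  "is_complete D \<longleftrightarrow> (\<forall>u\<in>verts D. \<forall>v\<in>verts D. u \<noteq> v \<longrightarrow> (u, v) \<in> arcs_ends D)"

text \<open>Meant for finite digraphs. The library does not count the empty digraph as strongly
  connected, but this does not affect the value: in a non-complete digraph, removing all vertices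
  except two distinct \<open>u\<close>, \<open>v\<close> with no arc from \<open>u\<close> to \<open>v\<close> already destroys strong connectivity.\<close>

definition vertex_connectivity :: "('a, 'b) pre_digraph \<Rightarrow> nat" where
  "vertex_connectivity D =
     (if is_complete D then card (verts D) - 1
      else (LEAST k. \<exists>X \<subseteq> verts D. finite X \<and> card X = k \<and>
                       \<not> strongly_connected (D \<restriction> (verts D - X))))"

end

theory Submission
  imports Defs
begin

text \<open>
  Identify a set of vertices with the union \<open>A\<close> of its cosets, so that its out-boundary is
  \<open>ASH - A\<close>. By submodularity of the boundary size, a smallest set \<open>A\<close> among those of minimal
  boundary, taken over \<open>S\<close> and \<open>S\<^sup>-\<^sup>1\<close> together, is equal to or disjoint from each of its
  translates, so up to translation it is a subgroup \<open>K\<close> containing \<open>H\<close>.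

  Put \<open>L = K \<inter> G'\<close>. If \<open>G' \<subseteq> K\<close>, a coset \<open>Ks\<close> with \<open>s \<notin> K\<close> already gives
  \<open>|G'/H|\<close> boundary vertices. Otherwise pick \<open>r \<in> R\<^sub>1 - K\<close>. The boundary of \<open>K\<close> contains the
  boundary of \<open>L\<close> in \<open>G'\<close> and, outside \<open>G'\<close>, the sets \<open>HsH\<close> for \<open>s \<in> R\<^sub>2 - K\<close> and \<open>HsHr\<close> for
  \<open>s \<in> R\<^sub>2 \<inter> K\<close>. A common element of some \<open>HsH\<close> and \<open>HtHr\<close> would give \<open>G'sG' = G'tG'\<close>,
  hence \<open>s \<in> \<langle>H, t\<rangle> \<subseteq> K\<close>. So the boundary has at least
  \<open>\<kappa>(\<G>') + d\<close> vertices for \<open>d\<close> the total degree of \<open>R\<^sub>2\<close>, unless \<open>L \<noteq> H\<close> together with its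
  boundary is all of \<open>G'\<close>; in that case a translate of \<open>L\<close> in the boundary of \<open>K\<close> outside \<open>G'\<close>
  brings the count up to \<open>|G'/H|\<close>.
\<close>

section \<open>Boundaries and atoms\<close>

text \<open>A vertex set is represented by the union of its cosets, so sizes are |H| times numbers
  of vertices. The trailing factor \<open>H\<close> makes the out-neighbourhood such a union
  again.\<close>

definition coset_nbhd :: "('a, 'm) monoid_scheme \<Rightarrow> 'a set \<Rightarrow> 'a set \<Rightarrow> 'a set \<Rightarrow> 'a set" where
  "coset_nbhd G H T A = (A <#>\<^bsub>G\<^esub> T) <#>\<^bsub>G\<^esub> H"

definition coset_boundary :: "('a, 'm) monoid_scheme \<Rightarrow> 'a set \<Rightarrow> 'a set \<Rightarrow> 'a set \<Rightarrow> 'a set" where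
  "coset_boundary G H T A = coset_nbhd G H T A - A"

text \<open>Closure under \<open>H\<close> makes \<open>A\<close> a union of left cosets. The last
  conjunct leaves a vertex that is neither in \<open>A\<close> nor an out-neighbour of
  \<open>A\<close>, so deleting the boundary cuts \<open>A\<close> off from something.\<close>

definition separates :: "('a, 'm) monoid_scheme \<Rightarrow> 'a set \<Rightarrow> 'a set \<Rightarrow> 'a set \<Rightarrow> bool" where
  "separates G H T A \<longleftrightarrow> A \<subseteq> carrier G \<and> A \<noteq> {} \<and> A <#>\<^bsub>G\<^esub> H \<subseteq> A \<and>
     A \<union> coset_nbhd G H T A \<noteq> carrier G"

lemma mem_coset_nbhd:
  "x \<in> coset_nbhd G H T A \<longleftrightarrow> (\<exists>a\<in>A. \<exists>t\<in>T. \<exists>h\<in>H. x = a \<otimes>\<^bsub>G\<^esub> t \<otimes>\<^bsub>G\<^esub> h)"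
  by (auto simp: coset_nbhd_def set_mult_def)

lemma coset_nbhd_mono: "A \<subseteq> B \<Longrightarrow> coset_nbhd G H T A \<subseteq> coset_nbhd G H T B"
  unfolding coset_nbhd_def by (intro mono_set_mult order_refl)

lemma coset_nbhd_Un: "coset_nbhd G H T (A \<union> B) = coset_nbhd G H T A \<union> coset_nbhd G H T B"
  by (auto simp: coset_nbhd_def set_mult_def)

lemma set_mult_Un_left: "(A \<union> B) <#>\<^bsub>G\<^esub> H = (A <#>\<^bsub>G\<^esub> H) \<union> (B <#>\<^bsub>G\<^esub> H)"
  by (auto simp: set_mult_def)

lemma set_mult_Int_left: "(A \<inter> B) <#>\<^bsub>G\<^esub> H \<subseteq> (A <#>\<^bsub>G\<^esub> H) \<inter> (B <#>\<^bsub>G\<^esub> H)"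
  by (auto simp: set_mult_def)

section \<open>Unions of cosets in a finite group, their boundaries and duals\<close>

locale finite_coset_space = group G for G (structure) +
  fixes H :: "'a set"
  assumes finite_carrier: "finite (carrier G)" and subgroup_H: "subgroup H G"
begin

lemma H_carrier: "h \<in> H \<Longrightarrow> h \<in> carrier G"
  using subgroup.subset[OF subgroup_H] by blast

lemma H_nonempty: "H \<noteq> {}"
  using subgroup.one_closed[OF subgroup_H] by blast

lemma finite_subset_carrier: "A \<subseteq> carrier G \<Longrightarrow> finite A"
  using finite_carrier finite_subset by blast

lemma card_H_pos: "card H > 0"
  using H_nonempty finite_subset_carrier[OF subgroup.subset[OF subgroup_H]] by (simp add: card_gt_0_iff)

lemma coset_nbhd_carrier:
  "A \<subseteq> carrier G \<Longrightarrow> T \<subseteq> carrier G \<Longrightarrow> coset_nbhd G H T A \<subseteq> carrier G"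
  unfolding coset_nbhd_def by (intro set_mult_closed subgroup.subset[OF subgroup_H])

lemma coset_boundary_carrier:
  "A \<subseteq> carrier G \<Longrightarrow> T \<subseteq> carrier G \<Longrightarrow> coset_boundary G H T A \<subseteq> carrier G"
  using coset_nbhd_carrier unfolding coset_boundary_def by blast

text \<open>Multiplying by \<open>inv h\<close> undoes a step along \<open>H\<close>, so an element
  outside \<open>B\<close> cannot enter \<open>B\<close>. This is what makes boundaries and
  complements unions of cosets.\<close>

lemma mult_H_Diff:
  assumes "A \<subseteq> carrier G" "B \<subseteq> carrier G" "A <#> H \<subseteq> A" "B <#> H \<subseteq> B"
  shows "(A - B) <#> H \<subseteq> A - B"
proof
  fix x assume "x \<in> (A - B) <#> H"
  then obtain a h where a: "a \<in> A" "a \<notin> B" "h \<in> H" "x = a \<otimes> h"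
    by (auto simp: set_mult_def)
  have "x \<in> A" using assms(3) a by (auto simp: set_mult_def)
  moreover have "x \<notin> B"
  proof
    assume "x \<in> B"
    then have "x \<otimes> inv h \<in> B"
      using assms(4) subgroup.m_inv_closed[OF subgroup_H a(3)] by (force simp: set_mult_def)
    moreover have "x \<otimes> inv h = a"
      using a assms(1) H_carrier[OF a(3)] by (simp add: m_assoc subset_iff)
    ultimately show False using a by simp
  qed
  ultimately show "x \<in> A - B" by simp
qed

lemma coset_nbhd_mult_H:
  assumes "A \<subseteq> carrier G" "T \<subseteq> carrier G"
  shows "coset_nbhd G H T A <#> H \<subseteq> coset_nbhd G H T A"
proof
  fix x assume "x \<in> coset_nbhd G H T A <#> H"
  then obtain a t h k where a: "a \<in> A" "t \<in> T" "h \<in> H" "k \<in> H" "x = a \<otimes> t \<otimes> h \<otimes> k"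
    by (auto simp: set_mult_def mem_coset_nbhd)
  then have "x = a \<otimes> t \<otimes> (h \<otimes> k)"
    using assms H_carrier by (simp add: m_assoc subset_iff)
  moreover have "h \<otimes> k \<in> H" using a subgroup.m_closed[OF subgroup_H] by blast
  ultimately show "x \<in> coset_nbhd G H T A" using a by (auto simp: mem_coset_nbhd)
qed

lemma carrier_mult_H: "carrier G <#> H \<subseteq> carrier G"
  by (intro set_mult_closed subgroup.subset[OF subgroup_H] order_refl)

text \<open>Inverting \<open>T\<close> reverses all arcs. A reversed arc from \<open>B\<close> into
  \<open>A\<close> would be an arc from \<open>A\<close> into \<open>B\<close>, but \<open>B\<close>
  avoids the out-neighbourhood of \<open>A\<close>. So reversed arcs leaving \<open>B\<close> end in
  the boundary of \<open>A\<close>.\<close>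

lemma separates_dual:
  assumes T: "T \<subseteq> carrier G" and A: "separates G H T A"
  defines "B \<equiv> carrier G - (A \<union> coset_nbhd G H T A)"
  shows "separates G H (m_inv G ` T) B"
    and "coset_boundary G H (m_inv G ` T) B \<subseteq> coset_boundary G H T A"
proof -
  let ?T = "m_inv G ` T"
  have Ac: "A \<subseteq> carrier G" "A \<noteq> {}" "A <#> H \<subseteq> A" "A \<union> coset_nbhd G H T A \<noteq> carrier G"
    using A by (auto simp: separates_def)
  have T': "?T \<subseteq> carrier G" using T by auto
  have Bc: "B \<subseteq> carrier G" by (auto simp: B_def)
  have Nc: "coset_nbhd G H T A \<subseteq> carrier G" using coset_nbhd_carrier Ac T by blast
  have Bne: "B \<noteq> {}" using Ac Nc unfolding B_def by blast
  have "(A \<union> coset_nbhd G H T A) <#> H \<subseteq> A \<union> coset_nbhd G H T A"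
    using Ac(3) coset_nbhd_mult_H[OF Ac(1) T] by (auto simp: set_mult_Un_left)
  then have BH: "B <#> H \<subseteq> B"
    unfolding B_def using Ac Nc carrier_mult_H by (intro mult_H_Diff) auto
  have disj: "coset_nbhd G H ?T B \<inter> A = {}"
  proof (rule ccontr)
    assume "\<not> ?thesis"
    then obtain b t h where b: "b \<in> B" "t \<in> T" "h \<in> H" "b \<otimes> inv t \<otimes> h \<in> A"
      by (auto simp: mem_coset_nbhd)
    have c: "b \<in> carrier G" "t \<in> carrier G" "h \<in> carrier G"
      using b Bc T H_carrier by auto
    have "b \<otimes> inv t \<otimes> h \<otimes> inv h \<in> A"
      using Ac(3) b subgroup.m_inv_closed[OF subgroup_H b(3)] by (force simp: set_mult_def)
    then have "b \<otimes> inv t \<in> A" using c by (simp add: m_assoc)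
    moreover have "b = (b \<otimes> inv t) \<otimes> t \<otimes> \<one>" using c by (simp add: m_assoc)
    ultimately have "b \<in> coset_nbhd G H T A"
      using b(2) subgroup.one_closed[OF subgroup_H] unfolding mem_coset_nbhd by blast
    then show False using b by (simp add: B_def)
  qed
  then have "B \<union> coset_nbhd G H ?T B \<noteq> carrier G"
    using Ac unfolding B_def by blast
  then show "separates G H ?T B"
    using Bc Bne BH by (simp add: separates_def)
  show "coset_boundary G H ?T B \<subseteq> coset_boundary G H T A"
    using disj coset_nbhd_carrier[OF Bc T'] unfolding coset_boundary_def B_def by blast
qed

text \<open>The union of the two boundaries on the left lies in the union of those on the right, and
  likewise for the intersections, because neighbourhoods commute with unions and are monotone.
  Inclusion-exclusion turns this into the inequality.\<close>

lemma card_boundary_submodular: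
  assumes "A \<subseteq> carrier G" "B \<subseteq> carrier G" "T \<subseteq> carrier G"
  shows "card (coset_boundary G H T (A \<union> B)) + card (coset_boundary G H T (A \<inter> B))
    \<le> card (coset_boundary G H T A) + card (coset_boundary G H T B)"
proof -
  let ?d = "coset_boundary G H T"
  have fin: "finite (?d X)" if "X \<subseteq> carrier G" for X
    using finite_subset_carrier[OF coset_boundary_carrier[OF that assms(3)]] .
  have I: "coset_nbhd G H T (A \<inter> B) \<subseteq> coset_nbhd G H T A \<inter> coset_nbhd G H T B"
    by (simp add: coset_nbhd_mono)
  have "card (?d (A \<union> B)) + card (?d (A \<inter> B)) =
      card (?d (A \<union> B) \<union> ?d (A \<inter> B)) + card (?d (A \<union> B) \<inter> ?d (A \<inter> B))"
    using assms by (intro card_Un_Int fin) auto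
  also have "\<dots> \<le> card (?d A \<union> ?d B) + card (?d A \<inter> ?d B)"
    using I assms by (intro add_mono card_mono finite_UnI finite_Int disjI1 fin)
      (auto simp: coset_boundary_def coset_nbhd_Un)
  also have "\<dots> = card (?d A) + card (?d B)"
    using assms by (intro card_Un_Int[symmetric] fin) auto
  finally show ?thesis .
qed

text \<open>Left translations are automorphisms of the digraph, since arcs come from multiplication
  on the right.\<close>

lemma coset_nbhd_translate:
  assumes "g \<in> carrier G" "A \<subseteq> carrier G" "T \<subseteq> carrier G"
  shows "coset_nbhd G H T ((\<otimes>) g ` A) = (\<otimes>) g ` coset_nbhd G H T A"
proof -
  have "g \<otimes> a \<otimes> t \<otimes> h = g \<otimes> (a \<otimes> t \<otimes> h)" if "a \<in> A" "t \<in> T" "h \<in> H" for a t h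
    using that assms H_carrier by (simp add: m_assoc subset_iff)
  then show ?thesis by (force simp: mem_coset_nbhd image_iff)
qed

lemma inj_on_translate: "g \<in> carrier G \<Longrightarrow> inj_on ((\<otimes>) g) (carrier G)"
  by (rule inj_on_cmult)

lemma card_translate:
  "g \<in> carrier G \<Longrightarrow> A \<subseteq> carrier G \<Longrightarrow> card ((\<otimes>) g ` A) = card A"
  using inj_on_translate inj_on_subset card_image by metis

lemma card_coset_boundary_translate:
  assumes "g \<in> carrier G" "A \<subseteq> carrier G" "T \<subseteq> carrier G"
  shows "card (coset_boundary G H T ((\<otimes>) g ` A)) = card (coset_boundary G H T A)"
proof -
  have "coset_boundary G H T ((\<otimes>) g ` A) = (\<otimes>) g ` coset_boundary G H T A"
    unfolding coset_boundary_def coset_nbhd_translate[OF assms]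
    using inj_on_image_set_diff[OF inj_on_translate[OF assms(1)], of "coset_nbhd G H T A" A]
      coset_nbhd_carrier[OF assms(2,3)] assms(2) by blast
  then show ?thesis using card_translate[OF assms(1) coset_boundary_carrier[OF assms(2,3)]] by simp
qed

lemma separates_translate:
  assumes "g \<in> carrier G" "T \<subseteq> carrier G" "separates G H T A"
  shows "separates G H T ((\<otimes>) g ` A)"
proof -
  have A: "A \<subseteq> carrier G" "A \<noteq> {}" "A <#> H \<subseteq> A" "A \<union> coset_nbhd G H T A \<noteq> carrier G"
    using assms by (auto simp: separates_def)
  have Nc: "A \<union> coset_nbhd G H T A \<subseteq> carrier G" using coset_nbhd_carrier[OF A(1) assms(2)] A(1) by blast
  have gA: "(\<otimes>) g ` A \<subseteq> carrier G" using A assms by auto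
  have "((\<otimes>) g ` A) <#> H \<subseteq> (\<otimes>) g ` A"
  proof
    fix x assume "x \<in> ((\<otimes>) g ` A) <#> H"
    then obtain a h where a: "a \<in> A" "h \<in> H" "x = g \<otimes> a \<otimes> h" by (auto simp: set_mult_def)
    then have "a \<otimes> h \<in> A" using A(3) by (auto simp: set_mult_def)
    moreover have "x = g \<otimes> (a \<otimes> h)" using a A assms H_carrier by (simp add: m_assoc subset_iff)
    ultimately show "x \<in> (\<otimes>) g ` A" by blast
  qed
  moreover have "(\<otimes>) g ` (A \<union> coset_nbhd G H T A) \<noteq> carrier G"
    using card_translate[OF assms(1) Nc] card_subset_eq[OF finite_carrier Nc] A(4) by auto
  ultimately show ?thesis
    using gA A(2) coset_nbhd_translate[OF assms(1) A(1) assms(2)]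
    by (simp add: separates_def image_Un)
qed

text \<open>An atom and a translate of it that meet must coincide: otherwise submodularity
  forces the union to have so small a boundary that it cannot be separating, and then the
  complementary part of the atom is too small.\<close>

lemma atom_translate:
  assumes T: "T \<subseteq> carrier G" and sA: "separates G H T A" and sB: "separates G H T B"
    and cAB: "card B = card A" "card (coset_boundary G H T B) = card (coset_boundary G H T A)"
    and min_bd: "\<And>X. separates G H T X \<Longrightarrow> card (coset_boundary G H T A) \<le> card (coset_boundary G H T X)"
    and min_card: "\<And>X. separates G H T X \<Longrightarrow>
      card (coset_boundary G H T X) = card (coset_boundary G H T A) \<Longrightarrow> card A \<le> card X"
    and small: "card A \<le> card (carrier G - (A \<union> coset_nbhd G H T A))"
    and meet: "A \<inter> B \<noteq> {}"
  shows "B = A"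
proof (rule ccontr)
  assume "B \<noteq> A"
  let ?d = "coset_boundary G H T" and ?N = "coset_nbhd G H T"
  have A: "A \<subseteq> carrier G" "A <#> H \<subseteq> A" "A \<union> ?N A \<noteq> carrier G"
    and B: "B \<subseteq> carrier G" "B <#> H \<subseteq> B" using sA sB by (auto simp: separates_def)
  have fin: "finite A" "finite B" using A B finite_subset_carrier by auto
  have "A \<inter> B \<noteq> A" using \<open>B \<noteq> A\<close> cAB(1) fin by (metis card_subset_eq inf.absorb_iff1)
  then have less: "card (A \<inter> B) < card A" using fin by (intro psubset_card_mono) auto
  have pos: "card (A \<inter> B) > 0" using meet fin by (simp add: card_gt_0_iff)
  have NA: "?N A \<subseteq> carrier G" "?N (A \<union> B) \<subseteq> carrier G" using coset_nbhd_carrier A B T by auto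
  have "?N (A \<inter> B) \<subseteq> ?N A" by (simp add: coset_nbhd_mono)
  then have "A \<inter> B \<union> ?N (A \<inter> B) \<noteq> carrier G" using A(1,3) NA(1) by blast
  moreover have "(A \<inter> B) <#> H \<subseteq> A \<inter> B" using set_mult_Int_left[of G A B H] A(2) B(2) by blast
  ultimately have sI: "separates G H T (A \<inter> B)"
    using A(1) meet unfolding separates_def by blast
  \<comment> \<open>The intersection separates too but is smaller than \<open>A\<close>, so by
    \<open>min_card\<close> it cannot attain the minimal boundary. Submodularity then forces the
    union below the minimum.\<close>
  have "card (?d A) < card (?d (A \<inter> B))"
    using min_bd[OF sI] min_card[OF sI] less by linarith
  then have dU: "card (?d (A \<union> B)) < card (?d A)"
    using card_boundary_submodular[OF A(1) B(1) T] cAB by linarith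
  then have "\<not> separates G H T (A \<union> B)" using min_bd by force
  moreover have "(A \<union> B) <#> H \<subseteq> A \<union> B" using A(2) B(2) unfolding set_mult_Un_left by blast
  ultimately have "A \<union> B \<union> ?N (A \<union> B) = carrier G"
    using A(1) B(1) meet unfolding separates_def by blast
  then have "carrier G = (A \<union> B) \<union> ?d (A \<union> B)" by (auto simp: coset_boundary_def)
  \<comment> \<open>Count the group twice. This bound is less than 2|A| plus the boundary of
    \<open>A\<close>, as the intersection is nonempty; splitting the group into \<open>A\<close>,
    its boundary and the rest gives at least that much by \<open>small\<close>.\<close>
  then have "card (carrier G) \<le> card (A \<union> B) + card (?d (A \<union> B))"
    using card_Un_le by metis
  moreover have "card (A \<union> B) + card (A \<inter> B) = card A + card B"
    using card_Un_Int[OF fin] by simp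
  moreover have "card (carrier G - (A \<union> ?N A)) + card (A \<union> ?N A) = card (carrier G)"
    using A NA finite_carrier by (simp add: card_Diff_subset card_mono finite_subset_carrier)
  moreover have "card (A \<union> ?N A) = card A + card (?d A)"
    using card_Un_disjoint[of A "?d A"] fin finite_subset_carrier[OF coset_boundary_carrier[OF A(1) T]]
    by (simp add: coset_boundary_def)
  ultimately show False using dU small pos cAB by linarith
qed

text \<open>Translates that stay inside \<open>A\<close> give closure under products; that
  \<open>x\<close> times \<open>A\<close> still contains \<open>\<one>\<close> gives
  inverses.\<close>

lemma subgroup_of_translates:
  assumes A: "A \<subseteq> carrier G" "\<one> \<in> A"
    and tr: "\<And>g. g \<in> A \<Longrightarrow> (\<otimes>) g ` A = A"
  shows "subgroup A G"
proof (rule subgroup.intro)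
  show "A \<subseteq> carrier G" "\<one> \<in> A" by fact+
  show "x \<otimes> y \<in> A" if "x \<in> A" "y \<in> A" for x y using tr that by blast
  show "inv x \<in> A" if x: "x \<in> A" for x
  proof -
    obtain y where y: "y \<in> A" "x \<otimes> y = \<one>" using tr[OF x] A by force
    have "x \<in> carrier G" "y \<in> carrier G" using x y A by auto
    then have "inv x = y" using y(2) inv_solve_left[of y x \<one>] by simp
    then show ?thesis using y by simp
  qed
qed

text \<open>Minimising over both directions of the arcs lets an atom be compared with its
  complementary part, which separates in the reversed digraph. The price is that \<open>U\<close>
  may be either \<open>T\<close> or its set of inverses.\<close>

lemma exists_atom_subgroup:
  assumes T: "T \<subseteq> carrier G" and "separates G H T A0"
  obtains K U where "U = T \<or> U = m_inv G ` T" "subgroup K G" "H \<subseteq> K" "separates G H U K"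
    "\<And>A. separates G H T A \<Longrightarrow> card (coset_boundary G H U K) \<le> card (coset_boundary G H T A)"
proof -
  let ?d = "coset_boundary G H"
  \<comment> \<open>Pairs of a direction and a separating set. First the boundary size is minimised,
    with minimum \<open>k\<close>; then \<open>Q\<close> selects the minimisers and the size of the
    set is minimised among them.\<close>
  define P where "P = (\<lambda>(U, A). (U = T \<or> U = m_inv G ` T) \<and> separates G H U A)"
  have "P (T, A0)" using assms by (simp add: P_def)
  then obtain p where p: "P p" "\<And>q. P q \<Longrightarrow> card (case_prod ?d p) \<le> card (case_prod ?d q)"
    using ex_has_least_nat[of P _ "\<lambda>q. card (case_prod ?d q)"] by blast
  define k where "k = card (case_prod ?d p)"
  define Q where "Q q \<longleftrightarrow> P q \<and> card (case_prod ?d q) = k" for q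
  have "Q p" using p by (simp add: Q_def k_def)
  then obtain q where q: "Q q" "\<And>r. Q r \<Longrightarrow> card (snd q) \<le> card (snd r)"
    using ex_has_least_nat[of Q _ "\<lambda>q. card (snd q)"] by blast
  obtain U A where UA: "q = (U, A)" by force
  have U: "U = T \<or> U = m_inv G ` T" and sA: "separates G H U A" and dA: "card (?d U A) = k"
    using q(1) by (auto simp: Q_def P_def UA)
  have min_bd: "k \<le> card (?d V X)" if "V = T \<or> V = m_inv G ` T" "separates G H V X" for V X
    using p(2)[of "(V, X)"] that by (auto simp: P_def k_def)
  have min_card: "card A \<le> card X"
    if "V = T \<or> V = m_inv G ` T" "separates G H V X" "card (?d V X) = k" for V X
    using q(2)[of "(V, X)"] that by (auto simp: P_def Q_def UA)
  have Uc: "U \<subseteq> carrier G" using U T by auto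
  have "m_inv G ` m_inv G ` T = T" using T by (force simp: image_iff)
  then have U': "m_inv G ` U = T \<or> m_inv G ` U = m_inv G ` T" using U by auto
  let ?B = "carrier G - (A \<union> coset_nbhd G H U A)"
  have Ac: "A \<subseteq> carrier G" "A \<noteq> {}" "A <#> H \<subseteq> A" using sA by (auto simp: separates_def)
  have sB: "separates G H (m_inv G ` U) ?B" by (rule separates_dual(1)[OF Uc sA])
  moreover have "card (?d (m_inv G ` U) ?B) \<le> k"
    using card_mono[OF finite_subset_carrier separates_dual(2)[OF Uc sA]] coset_boundary_carrier[OF Ac(1) Uc]
    unfolding dA by blast
  \<comment> \<open>The complementary part has boundary at most \<open>k\<close> in the opposite
    direction, hence exactly \<open>k\<close>, so it competes with \<open>A\<close> in size.\<close>
  ultimately have small: "card A \<le> card ?B"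
    using min_bd[OF U'] min_card[OF U'] by (simp add: le_antisym)
  have atom: "(\<otimes>) g ` A = A" if "g \<in> carrier G" "A \<inter> (\<otimes>) g ` A \<noteq> {}" for g
    using atom_translate[OF Uc sA separates_translate[OF that(1) Uc sA] card_translate[OF that(1) Ac(1)]
        card_coset_boundary_translate[OF that(1) Ac(1) Uc] _ _ small that(2)]
      min_bd[OF U] min_card[OF U] dA by simp
  obtain a where a: "a \<in> A" using Ac by blast
  \<comment> \<open>The atom is moved so that it contains \<open>\<one>\<close>.\<close>
  define K where "K = (\<otimes>) (inv a) ` A"
  have ac: "a \<in> carrier G" using a Ac by blast
  have sK: "separates G H U K" and dK: "card (?d U K) = k"
    using separates_translate[OF _ Uc sA] card_coset_boundary_translate[OF _ Ac(1) Uc] ac dA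
    by (auto simp: K_def)
  have K1: "\<one> \<in> K" using a ac by (force simp: K_def image_iff)
  have Kc: "K \<subseteq> carrier G" "K <#> H \<subseteq> K" using sK by (auto simp: separates_def)
  have "(\<otimes>) g ` K = K" if g: "g \<in> K" for g
  proof -
    obtain b where b: "b \<in> A" "g = inv a \<otimes> b" using g by (auto simp: K_def)
    have bc: "b \<in> carrier G" using b Ac by blast
    have comp: "(\<otimes>) (x \<otimes> y) ` A = (\<otimes>) x ` (\<otimes>) y ` A" if "x \<in> carrier G" "y \<in> carrier G" for x y
      using that Ac(1) by (force simp: image_image m_assoc subset_iff)
    \<comment> \<open>Thus \<open>b\<close> lies both in \<open>A\<close> and in its translate by
      \<open>b \<otimes> inv a\<close>, so the two coincide; conjugating by \<open>a\<close> gives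
      the invariance of \<open>K\<close> under \<open>g\<close>.\<close>
    have "b = b \<otimes> inv a \<otimes> a" using ac bc by (simp add: m_assoc)
    then have "A \<inter> (\<otimes>) (b \<otimes> inv a) ` A \<noteq> {}" using a b by blast
    then have e: "(\<otimes>) (b \<otimes> inv a) ` A = A" using atom ac bc by blast
    have "(\<otimes>) g ` K = (\<otimes>) (inv a \<otimes> (b \<otimes> inv a)) ` A"
      using comp[of g "inv a"] ac bc b by (simp add: K_def m_assoc)
    also have "\<dots> = K" using comp[of "inv a" "b \<otimes> inv a"] ac bc e by (simp add: K_def)
    finally show ?thesis .
  qed
  then have sub: "subgroup K G" using subgroup_of_translates Kc K1 by blast
  have HK: "H \<subseteq> K"
  proof
    fix h assume "h \<in> H"
    then have "\<one> \<otimes> h \<in> K" using Kc(2) K1 by (auto simp: set_mult_def)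
    then show "h \<in> K" using H_carrier[OF \<open>h \<in> H\<close>] by simp
  qed
  show thesis by (rule that[OF U sub HK sK]) (simp add: dK min_bd)
qed

section \<open>Vertex connectivity in terms of boundaries\<close>

lemma lcoset_subset_if_meets:
  assumes "C \<in> lcosets H" "Y \<subseteq> carrier G" "Y <#> H \<subseteq> Y" "C \<inter> Y \<noteq> {}"
  shows "C \<subseteq> Y"
proof -
  obtain x where x: "x \<in> carrier G" "C = x <# H" using assms(1) by (auto simp: LCOSETS_def)
  obtain y where y: "y \<in> C" "y \<in> Y" using assms by blast
  have "C = y <# H" using l_repr_independence[OF _ x(1) subgroup_H] x y by blast
  then show ?thesis using assms(3) y by (auto simp: l_coset_def set_mult_def)
qed

lemma lcosets_mult_H:
  assumes "C \<in> lcosets H"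
  shows "C \<subseteq> carrier G" "C \<noteq> {}" "C <#> H \<subseteq> C"
proof -
  obtain x where x: "x \<in> carrier G" "C = x <# H" using assms by (auto simp: LCOSETS_def)
  show "C \<subseteq> carrier G" using x l_coset_subset_G subgroup.subset[OF subgroup_H] by blast
  show "C \<noteq> {}" using lcos_self[OF x(1) subgroup_H] x by blast
  have "C <#> H = x <# (H <#> H)"
    using x setmult_lcos_assoc subgroup.subset[OF subgroup_H] by blast
  then show "C <#> H \<subseteq> C" using subgroup_mult_id[OF subgroup_H] x by simp
qed

text \<open>Left cosets are disjoint and all of size |H|. This converts numbers of vertices into
  numbers of group elements.\<close>

lemma card_lcosets_in:
  assumes "Y \<subseteq> carrier G" "Y <#> H \<subseteq> Y"
  shows "card {C \<in> lcosets H. C \<subseteq> Y} * card H = card Y"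
proof -
  let ?F = "{C \<in> lcosets H. C \<subseteq> Y}"
  have U: "\<Union>?F = Y"
  proof
    show "Y \<subseteq> \<Union>?F"
    proof
      fix y assume y: "y \<in> Y"
      then have "y <# H \<in> lcosets H" "y \<in> y <# H"
        using assms lcos_self subgroup_H by (auto simp: LCOSETS_def)
      moreover from this have "y <# H \<subseteq> Y" using lcoset_subset_if_meets assms y by blast
      ultimately show "y \<in> \<Union>?F" by blast
    qed
  qed auto
  have "card H * card ?F = card (\<Union>?F)"
  proof (rule card_partition)
    show "finite (\<Union>?F)" using U finite_subset_carrier assms by simp
    then show "finite ?F" using finite_UnionD by blast
    show "card c = card H" if "c \<in> ?F" for c
      using l_card_cosets_equal[OF _ subgroup.subset[OF subgroup_H] finite_carrier, of c] that by simp
    show "c \<inter> d = {}" if "c \<in> ?F" "d \<in> ?F" "c \<noteq> d" for c d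
      using lcos_disjoint[OF subgroup_H] that by blast
  qed
  then show ?thesis using U by (simp add: mult.commute)
qed

lemma finite_lcosets: "finite (lcosets H)"
  using finite_carrier lcosets_part_G[OF subgroup_H] finite_UnionD by metis

section \<open>Cuts of the Cayley coset digraph\<close>

lemma pverts_cayley: "pverts (cayley_coset_digraph G H T) = lcosets H"
  by (simp add: cayley_coset_digraph_def)

text \<open>The neighbourhood of \<open>A\<close> is a union of cosets, so a coset meeting it lies
  inside it. Conversely the factor from \<open>H\<close> can be cancelled because \<open>B\<close>
  is closed under \<open>H\<close>.\<close>

lemma parcs_cayley:
  assumes "T \<subseteq> carrier G"
  shows "(A, B) \<in> parcs (cayley_coset_digraph G H T) \<longleftrightarrow>
    A \<in> lcosets H \<and> B \<in> lcosets H \<and> B \<subseteq> coset_nbhd G H T A"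
proof -
  have "(\<exists>t\<in>T. (A #> t) \<inter> B \<noteq> {}) \<longleftrightarrow> B \<subseteq> coset_nbhd G H T A"
    if A: "A \<in> lcosets H" and B: "B \<in> lcosets H"
  proof
    have Ac: "A \<subseteq> carrier G" using lcosets_mult_H A by blast
    {
      assume "\<exists>t\<in>T. (A #> t) \<inter> B \<noteq> {}"
      then obtain t a where t: "t \<in> T" "a \<in> A" "a \<otimes> t \<in> B" by (auto simp: r_coset_def)
      then have "a \<otimes> t = a \<otimes> t \<otimes> \<one>" using Ac assms by (simp add: subset_iff)
      then have "a \<otimes> t \<in> coset_nbhd G H T A"
        using t subgroup.one_closed[OF subgroup_H] unfolding mem_coset_nbhd by blast
      then show "B \<subseteq> coset_nbhd G H T A"
        using lcoset_subset_if_meets[OF B coset_nbhd_carrier[OF Ac assms] coset_nbhd_mult_H[OF Ac assms]] t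
        by blast
    }
    assume "B \<subseteq> coset_nbhd G H T A"
    then obtain a t h where a: "a \<in> A" "t \<in> T" "h \<in> H" "a \<otimes> t \<otimes> h \<in> B"
      using lcosets_mult_H(2)[OF B] by (force simp: mem_coset_nbhd)
    then have "a \<otimes> t \<otimes> h \<otimes> inv h \<in> B"
      using lcosets_mult_H(3)[OF B] subgroup.m_inv_closed[OF subgroup_H a(3)] by (force simp: set_mult_def)
    then have "a \<otimes> t \<in> B" using a Ac assms H_carrier by (simp add: m_assoc subset_iff)
    then show "\<exists>t\<in>T. (A #> t) \<inter> B \<noteq> {}" using a by (auto simp: r_coset_def)
  qed
  then show ?thesis by (auto simp: cayley_coset_digraph_def)
qed

lemma arcs_ends_induce_cayley:
  "arcs_ends (with_proj (cayley_coset_digraph G H T) \<restriction> W) =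
     {(A, B) \<in> parcs (cayley_coset_digraph G H T). A \<in> W \<and> B \<in> W}"
  by (auto simp: arcs_ends_def arc_to_ends_def)

lemma separates_imp_not_complete:
  assumes T: "T \<subseteq> carrier G" and A: "separates G H T A"
  obtains u v where "u \<in> lcosets H" "v \<in> lcosets H" "u \<subseteq> A" "v \<inter> (A \<union> coset_nbhd G H T A) = {}"
    "\<not> is_complete (with_proj (cayley_coset_digraph G H T))"
proof -
  have Ac: "A \<subseteq> carrier G" "A \<noteq> {}" "A <#> H \<subseteq> A" "A \<union> coset_nbhd G H T A \<noteq> carrier G"
    using A by (auto simp: separates_def)
  note N = coset_nbhd_carrier[OF Ac(1) T] coset_nbhd_mult_H[OF Ac(1) T]
  obtain a where a: "a \<in> A" using Ac by blast
  obtain b where b: "b \<in> carrier G" "b \<notin> A \<union> coset_nbhd G H T A" using Ac N by blast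
  define u v where "u = a <# H" and "v = b <# H"
  have u: "u \<in> lcosets H" "a \<in> u" and v: "v \<in> lcosets H" "b \<in> v"
    using a b Ac lcos_self subgroup_H by (auto simp: LCOSETS_def u_def v_def)
  have uA: "u \<subseteq> A" using lcoset_subset_if_meets[OF u(1) Ac(1,3)] u a by blast
  have vN: "v \<inter> (A \<union> coset_nbhd G H T A) = {}"
    using lcoset_subset_if_meets[OF v(1) Ac(1,3)] lcoset_subset_if_meets[OF v(1) N] v b by blast
  have "u \<noteq> v" using uA vN u by blast
  moreover have "(u, v) \<notin> parcs (cayley_coset_digraph G H T)"
    using parcs_cayley[OF T] coset_nbhd_mono[OF uA, of G H T] vN v by blast
  ultimately have "\<not> is_complete (with_proj (cayley_coset_digraph G H T))"
    using u v by (auto simp: is_complete_def pverts_cayley)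
  then show thesis using that u v uA vN by blast
qed

text \<open>The cosets in the boundary form a vertex cut: without them no walk starting inside
  \<open>A\<close> can leave \<open>A\<close>.\<close>

lemma vertex_connectivity_le_boundary:
  assumes T: "T \<subseteq> carrier G" and A: "separates G H T A"
  shows "vertex_connectivity (with_proj (cayley_coset_digraph G H T)) * card H
    \<le> card (coset_boundary G H T A)"
proof -
  let ?D = "with_proj (cayley_coset_digraph G H T)"
  have Ac: "A \<subseteq> carrier G" "A <#> H \<subseteq> A" using A by (auto simp: separates_def)
  obtain u v where u: "u \<in> lcosets H" "u \<subseteq> A" and v: "v \<in> lcosets H" "v \<inter> (A \<union> coset_nbhd G H T A) = {}"
    and nc: "\<not> is_complete ?D"
    using separates_imp_not_complete[OF T A] by metis
  define X where "X = {C \<in> lcosets H. C \<subseteq> coset_boundary G H T A}"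
  have ne: "C \<noteq> {}" if "C \<in> lcosets H" for C using lcosets_mult_H that by blast
  have uX: "u \<notin> X" and vX: "v \<notin> X" using u v ne unfolding X_def coset_boundary_def by blast+
  have bc: "coset_boundary G H T A \<subseteq> carrier G" by (rule coset_boundary_carrier[OF Ac(1) T])
  have "coset_boundary G H T A <#> H \<subseteq> coset_boundary G H T A"
    unfolding coset_boundary_def
    by (intro mult_H_Diff coset_nbhd_carrier coset_nbhd_mult_H Ac T)
  then have card_X: "card X * card H = card (coset_boundary G H T A)"
    unfolding X_def using card_lcosets_in[OF bc] by blast
  let ?W = "lcosets H - X"
  have "\<not> u \<rightarrow>\<^sup>*\<^bsub>?D \<restriction> ?W\<^esub> v"
  proof
    assume "u \<rightarrow>\<^sup>*\<^bsub>?D \<restriction> ?W\<^esub> v"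
    then have "(u, v) \<in> (arcs_ends (?D \<restriction> ?W))\<^sup>*" by (rule reachable_rtranclI)
    \<comment> \<open>Invariant along the walk: the next coset lies in the neighbourhood of
      \<open>A\<close>, and since it was not deleted it is not contained in the boundary, so it
      meets \<open>A\<close> and lies in it.\<close>
    then have "v \<subseteq> A"
    proof (induction rule: rtrancl_induct)
      case base
      then show ?case using u by simp
    next
      case (step y z)
      then have z: "(y, z) \<in> parcs (cayley_coset_digraph G H T)" "z \<in> lcosets H" "z \<notin> X"
        by (auto simp: arcs_ends_induce_cayley)
      then have "z \<subseteq> coset_nbhd G H T A"
        using parcs_cayley[OF T] coset_nbhd_mono[OF step.IH, of G H T] by blast
      then have "z \<inter> A \<noteq> {}" using z by (auto simp: X_def coset_boundary_def)
      then show ?case using lcoset_subset_if_meets[OF z(2) Ac] by blast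
    qed
    then show False using v ne by blast
  qed
  then have nsc: "\<not> strongly_connected (?D \<restriction> (verts ?D - X))"
    using u v uX vX by (auto simp: strongly_connected_def pverts_cayley)
  have "X \<subseteq> verts ?D" "finite X" using finite_lcosets by (auto simp: X_def pverts_cayley)
  then have "vertex_connectivity ?D \<le> card X"
    unfolding vertex_connectivity_def using nc nsc by (auto intro!: Least_le)
  then show ?thesis using card_X by (metis mult_le_mono1)
qed

text \<open>Passing to the complementary part returns to the original direction without enlarging
  the boundary.\<close>

lemma vertex_connectivity_le_boundary_inv:
  assumes T: "T \<subseteq> carrier G" and A: "separates G H (m_inv G ` T) A"
  shows "vertex_connectivity (with_proj (cayley_coset_digraph G H T)) * card H
    \<le> card (coset_boundary G H (m_inv G ` T) A)"
proof -
  have T': "m_inv G ` T \<subseteq> carrier G" using T by auto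
  have TT: "m_inv G ` m_inv G ` T = T" using T by (force simp: image_iff)
  let ?B = "carrier G - (A \<union> coset_nbhd G H (m_inv G ` T) A)"
  have "separates G H T ?B" "coset_boundary G H T ?B \<subseteq> coset_boundary G H (m_inv G ` T) A"
    using separates_dual[OF T' A] unfolding TT by auto
  moreover have "finite (coset_boundary G H (m_inv G ` T) A)"
    using A T' by (intro finite_subset_carrier coset_boundary_carrier) (auto simp: separates_def)
  ultimately show ?thesis
    using vertex_connectivity_le_boundary[OF T] card_mono le_trans by metis
qed

text \<open>A single vertex \<open>u\<close> with a missing arc to some other vertex
  \<open>v\<close> already separates.\<close>

lemma not_complete_imp_separates:
  assumes T: "T \<subseteq> carrier G" and nc: "\<not> is_complete (with_proj (cayley_coset_digraph G H T))"
  obtains A where "separates G H T A"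
proof -
  obtain u v where uv: "u \<in> lcosets H" "v \<in> lcosets H" "u \<noteq> v" "(u, v) \<notin> parcs (cayley_coset_digraph G H T)"
    using nc by (auto simp: is_complete_def pverts_cayley)
  note u = lcosets_mult_H[OF uv(1)]
  have "v \<inter> u = {}" using lcos_disjoint[OF subgroup_H] uv by blast
  moreover have "\<not> v \<subseteq> coset_nbhd G H T u" using uv parcs_cayley[OF T] by blast
  ultimately have "u \<union> coset_nbhd G H T u \<noteq> carrier G" using lcosets_mult_H(1)[OF uv(2)] by blast
  then show thesis using that u by (auto simp: separates_def)
qed

text \<open>This says that the connectivity is at most the number of vertices minus one, scaled by
  |H|. In the non-complete case a separating set contains a whole coset and is disjoint from its
  boundary.\<close>

lemma vertex_connectivity_less_order:
  assumes T: "T \<subseteq> carrier G"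
  shows "vertex_connectivity (with_proj (cayley_coset_digraph G H T)) * card H + card H \<le> card (carrier G)"
proof -
  let ?D = "with_proj (cayley_coset_digraph G H T)"
  show ?thesis
  proof (cases "is_complete ?D")
    case True
    have "card (lcosets H) * card H = card (carrier G)"
      using l_lagrange[OF finite_carrier subgroup_H] by (simp add: order_def)
    \<comment> \<open>There is at least one vertex, so the subtraction of 1 in the complete case is
      not truncated.\<close>
    moreover have "H \<in> lcosets H"
      using lcos_mult_one[OF subgroup.subset[OF subgroup_H]] by (force simp: LCOSETS_def)
    then have "card (lcosets H) > 0" using finite_lcosets by (auto simp: card_gt_0_iff)
    then have "vertex_connectivity ?D + 1 = card (lcosets H)"
      using True by (simp add: vertex_connectivity_def pverts_cayley)
    ultimately show ?thesis by (metis add_mult_distrib mult_1 order_refl)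
  next
    case False
    then obtain A where A: "separates G H T A" using not_complete_imp_separates[OF T] by blast
    then have Ac: "A \<subseteq> carrier G" "A <#> H \<subseteq> A" "A \<noteq> {}" by (auto simp: separates_def)
    obtain u where u: "u \<in> lcosets H" "u \<subseteq> A" using separates_imp_not_complete[OF T A] by metis
    have fin: "finite A" "finite (coset_boundary G H T A)"
      using Ac T coset_boundary_carrier finite_subset_carrier by auto
    have "card H = card u" using l_card_cosets_equal u(1) subgroup.subset[OF subgroup_H] finite_carrier by blast
    then have "card H \<le> card A" using u fin card_mono by metis
    moreover have "card (coset_boundary G H T A) + card A = card (coset_boundary G H T A \<union> A)"
      using fin by (intro card_Un_disjoint[symmetric]) (auto simp: coset_boundary_def)
    moreover have "\<dots> \<le> card (carrier G)"
      using Ac coset_boundary_carrier[OF Ac(1) T] finite_carrier by (intro card_mono) auto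
    ultimately show ?thesis using vertex_connectivity_le_boundary[OF T A] by linarith
  qed
qed

text \<open>Given a minimum cut and vertices \<open>u\<close>, \<open>v\<close> with no path from
  \<open>u\<close> to \<open>v\<close> left, take all cosets still reachable from \<open>u\<close>.
  Every boundary coset of their union must belong to the cut.\<close>

lemma exists_boundary_le_vertex_connectivity:
  assumes T: "T \<subseteq> carrier G" and nc: "\<not> is_complete (with_proj (cayley_coset_digraph G H T))"
  obtains A where "separates G H T A"
    "card (coset_boundary G H T A) \<le> vertex_connectivity (with_proj (cayley_coset_digraph G H T)) * card H"
proof -
  let ?D = "with_proj (cayley_coset_digraph G H T)"
  let ?P = "\<lambda>k. \<exists>X \<subseteq> verts ?D. finite X \<and> card X = k \<and> \<not> strongly_connected (?D \<restriction> (verts ?D - X))"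
  \<comment> \<open>Deleting everything leaves the empty digraph, which does not count as strongly
    connected, so the \<open>LEAST\<close> is attained.\<close>
  have "?P (card (lcosets H))"
    using finite_lcosets by (intro exI[of _ "lcosets H"]) (auto simp: pverts_cayley strongly_connected_def)
  then have "?P (LEAST k. ?P k)" by (rule LeastI)
  then obtain X where X: "X \<subseteq> lcosets H" "finite X" "card X = vertex_connectivity ?D"
     "\<not> strongly_connected (?D \<restriction> (lcosets H - X))"
    using nc unfolding vertex_connectivity_def by (auto simp: pverts_cayley)
  let ?W = "lcosets H - X"
  \<comment> \<open>The degenerate cut consisting of all vertices is too large to be minimum; so the
    failure of strong connectivity is witnessed by two surviving vertices.\<close>
  have "X \<noteq> lcosets H"
  proof
    assume "X = lcosets H"
    then have "vertex_connectivity ?D * card H = card (carrier G)"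
      using X l_lagrange[OF finite_carrier subgroup_H] by (simp add: order_def)
    then show False using vertex_connectivity_less_order[OF T] card_H_pos by linarith
  qed
  then obtain u v where u: "u \<in> ?W" and v: "v \<in> ?W" and nr: "\<not> u \<rightarrow>\<^sup>*\<^bsub>?D \<restriction> ?W\<^esub> v"
    using X by (auto simp: strongly_connected_def)
  define F where "F = {w \<in> ?W. u \<rightarrow>\<^sup>*\<^bsub>?D \<restriction> ?W\<^esub> w}"
  define A where "A = \<Union>F"
  have uF: "u \<in> F" using u by (auto simp: F_def reachable_def)
  have FW: "F \<subseteq> lcosets H" by (auto simp: F_def)
  have Ac: "A \<subseteq> carrier G" "A <#> H \<subseteq> A" "A \<noteq> {}"
  proof -
    show "A \<subseteq> carrier G" using FW lcosets_mult_H(1) by (auto simp: A_def)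
    show "A \<noteq> {}" using uF FW lcosets_mult_H(2)[of u] by (auto simp: A_def)
    have "C <#> H \<subseteq> C" if "C \<in> F" for C using that FW lcosets_mult_H(3) by blast
    then show "A <#> H \<subseteq> A" by (fastforce simp: A_def set_mult_def)
  qed
  have closed: "z \<in> F" if z: "z \<in> ?W" "z \<inter> coset_nbhd G H T A \<noteq> {}" for z
  proof -
    obtain C where C: "C \<in> F" "z \<inter> coset_nbhd G H T C \<noteq> {}"
      using z(2) unfolding A_def mem_coset_nbhd disjoint_iff by blast
    have Cc: "C \<subseteq> carrier G" using C FW lcosets_mult_H(1) by blast
    have "z \<subseteq> coset_nbhd G H T C"
      using lcoset_subset_if_meets[OF _ coset_nbhd_carrier[OF Cc T] coset_nbhd_mult_H[OF Cc T]] C z by blast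
    then have "(C, z) \<in> arcs_ends (?D \<restriction> ?W)"
      using C z FW by (auto simp: arcs_ends_induce_cayley parcs_cayley[OF T] F_def)
    then have "u \<rightarrow>\<^sup>*\<^bsub>?D \<restriction> ?W\<^esub> z"
      using C z unfolding F_def reachable_def by (auto intro: rtrancl_on_into_rtrancl_on)
    then show "z \<in> F" using z by (simp add: F_def)
  qed
  have disjA: "w \<inter> A = {}" if "w \<in> lcosets H" "w \<notin> F" for w
    using that FW lcos_disjoint[OF subgroup_H] by (fastforce simp: A_def)
  have "v \<notin> F" using nr by (simp add: F_def)
  then have "v \<inter> (A \<union> coset_nbhd G H T A) = {}" using disjA closed v by blast
  then have "A \<union> coset_nbhd G H T A \<noteq> carrier G" using lcosets_mult_H(1,2)[of v] v by blast
  then have sA: "separates G H T A" using Ac by (simp add: separates_def)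
  have bc: "coset_boundary G H T A \<subseteq> carrier G" by (rule coset_boundary_carrier[OF Ac(1) T])
  have "coset_boundary G H T A <#> H \<subseteq> coset_boundary G H T A"
    unfolding coset_boundary_def
    by (intro mult_H_Diff coset_nbhd_carrier coset_nbhd_mult_H Ac T)
  then have "card {C \<in> lcosets H. C \<subseteq> coset_boundary G H T A} * card H = card (coset_boundary G H T A)"
    using card_lcosets_in[OF bc] by blast
  moreover have "{C \<in> lcosets H. C \<subseteq> coset_boundary G H T A} \<subseteq> X"
  proof (rule ccontr)
    assume "\<not> ?thesis"
    then obtain C where C: "C \<in> ?W" "C \<subseteq> coset_boundary G H T A" by blast
    then have "C \<noteq> {}" using lcosets_mult_H(2) by blast
    then have "C \<in> F" using closed C by (auto simp: coset_boundary_def)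
    then show False using C \<open>C \<noteq> {}\<close> by (auto simp: A_def coset_boundary_def)
  qed
  ultimately have "card (coset_boundary G H T A) \<le> vertex_connectivity ?D * card H"
    using card_mono[OF X(2)] X(3) by (metis mult_le_mono1)
  then show thesis using that sA by blast
qed

section \<open>The boundary of a subgroup\<close>

lemma mem_double_coset:
  "x \<in> double_coset G H' s \<longleftrightarrow> (\<exists>h\<in>H'. \<exists>k\<in>H'. x = h \<otimes> s \<otimes> k)"
  by (auto simp: double_coset_def r_coset_def set_mult_def)

lemma double_coset_carrier:
  "subgroup M G \<Longrightarrow> s \<in> carrier G \<Longrightarrow> double_coset G M s \<subseteq> carrier G"
  using subgroup.subset[of M G] by (auto simp: mem_double_coset subset_iff)

lemma double_coset_eqI:
  assumes M: "subgroup M G" and s: "s \<in> carrier G" "r \<in> double_coset G M s"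
  shows "double_coset G M r = double_coset G M s"
proof -
  have sub: "double_coset G M y \<subseteq> double_coset G M x"
    if xy: "x \<in> carrier G" "y \<in> double_coset G M x" for x y
  proof
    fix z assume "z \<in> double_coset G M y"
    then obtain h k where z: "h \<in> M" "k \<in> M" "z = h \<otimes> y \<otimes> k" by (auto simp: mem_double_coset)
    obtain a b where y: "a \<in> M" "b \<in> M" "y = a \<otimes> x \<otimes> b" using xy by (auto simp: mem_double_coset)
    have "z = (h \<otimes> a) \<otimes> x \<otimes> (b \<otimes> k)"
      using y z xy subgroup.mem_carrier[OF M] by (simp add: m_assoc)
    then show "z \<in> double_coset G M x"
      using y z subgroup.m_closed[OF M] unfolding mem_double_coset by blast
  qed
  obtain a b where r: "a \<in> M" "b \<in> M" "r = a \<otimes> s \<otimes> b" using s by (auto simp: mem_double_coset)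
  have c: "a \<in> carrier G" "b \<in> carrier G" using r subgroup.mem_carrier[OF M] by auto
  have "s = inv a \<otimes> r \<otimes> inv b" using r c s by (simp add: m_assoc inv_solve_left)
  then have "s \<in> double_coset G M r"
    using r subgroup.m_inv_closed[OF M] unfolding mem_double_coset by blast
  then show ?thesis using sub[OF s] sub[of r s] double_coset_carrier[OF M s(1)] s(2) by blast
qed

lemma mem_subgroup_cancel_right:
  assumes "subgroup M G" "x \<in> carrier G" "m \<in> M" "x \<otimes> m \<in> M" shows "x \<in> M"
proof -
  have "x = (x \<otimes> m) \<otimes> inv m" using assms subgroup.mem_carrier[OF assms(1)] by (simp add: m_assoc)
  then show ?thesis using assms subgroup.m_closed subgroup.m_inv_closed by metis
qed

lemma mem_subgroup_cancel_left:
  assumes "subgroup M G" "x \<in> carrier G" "m \<in> M" "m \<otimes> x \<in> M" shows "x \<in> M"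
proof -
  have "x = inv m \<otimes> (m \<otimes> x)"
    using assms subgroup.mem_carrier[OF assms(1)] by (simp add: m_assoc[symmetric])
  then show ?thesis using assms subgroup.m_closed subgroup.m_inv_closed by metis
qed

lemma double_coset_disjoint_subgroup:
  assumes "subgroup M G" "H \<subseteq> M" "s \<in> carrier G" "s \<notin> M"
  shows "double_coset G H s \<inter> M = {}"
proof (rule ccontr)
  assume "\<not> ?thesis"
  then obtain h k where h: "h \<in> H" "k \<in> H" "h \<otimes> s \<otimes> k \<in> M" by (auto simp: mem_double_coset)
  have "h \<otimes> s \<in> M" using mem_subgroup_cancel_right[OF assms(1) _ _ h(3)] h assms H_carrier by auto
  then show False using mem_subgroup_cancel_left[OF assms(1,3), of h] h assms by auto
qed

lemma card_right_translate:
  assumes "A \<subseteq> carrier G" "g \<in> carrier G"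
  shows "card (A #> g) = card A"
proof -
  have "A #> g = (\<lambda>a. a \<otimes> g) ` A" by (auto simp: r_coset_def)
  then show ?thesis using inj_on_g[OF assms] by (simp add: card_image)
qed

lemma card_Union_double_cosets:
  assumes "R \<subseteq> carrier G" "inj_on (double_coset G H) R"
  shows "card (\<Union>s\<in>R. double_coset G H s) = (\<Sum>s\<in>R. card (double_coset G H s))"
proof (rule card_UN_disjoint)
  show "finite R" using assms finite_subset_carrier by blast
  show "\<forall>s\<in>R. finite (double_coset G H s)"
    using assms double_coset_carrier[OF subgroup_H] finite_subset_carrier by blast
  show "\<forall>s\<in>R. \<forall>t\<in>R. s \<noteq> t \<longrightarrow> double_coset G H s \<inter> double_coset G H t = {}"
  proof (intro ballI impI, rule ccontr)
    fix s t assume st: "s \<in> R" "t \<in> R" "s \<noteq> t" "double_coset G H s \<inter> double_coset G H t \<noteq> {}"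
    then obtain x where "x \<in> double_coset G H s" "x \<in> double_coset G H t" by blast
    then have "double_coset G H s = double_coset G H t"
      using double_coset_eqI[OF subgroup_H] st assms(1) by blast
    then show False using st assms(2) by (auto dest: inj_onD)
  qed
qed

lemma right_coset_subset_nbhd:
  assumes "A \<subseteq> K" "K \<subseteq> carrier G" "t \<in> T" "T \<subseteq> carrier G"
  shows "A #> t \<subseteq> coset_nbhd G H T K"
proof
  fix x assume "x \<in> A #> t"
  then obtain a where a: "a \<in> A" "x = a \<otimes> t" by (auto simp: r_coset_def)
  then have "x = a \<otimes> t \<otimes> \<one>" using assms by (auto simp: subset_iff)
  then show "x \<in> coset_nbhd G H T K"
    using a assms subgroup.one_closed[OF subgroup_H] unfolding mem_coset_nbhd by blast
qed

lemma right_coset_disjoint_subgroup: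
  assumes "subgroup K G" "A \<subseteq> K" "t \<in> carrier G" "t \<notin> K"
  shows "(A #> t) \<inter> K = {}"
  using mem_subgroup_cancel_left[OF assms(1,3)] assms(2,4) by (auto simp: r_coset_def)

text \<open>\<open>R1\<close> and \<open>R2\<close> are arbitrary here so that they can also be the
  sets of inverses. The alternative with \<open>card H\<close> covers
  \<open>K \<inter> M = H\<close> when \<open>H\<close> and its neighbours fill \<open>M\<close>:
  the boundary then has |M| - |H| elements, which still bounds the connectivity inside
  \<open>M\<close>.\<close>

lemma subgroup_boundary_bound:
  assumes K: "subgroup K G" "H \<subseteq> K" "separates G H (R1 \<union> R2) K"
    and R1: "R1 \<subseteq> carrier G" and R2: "R2 \<subseteq> carrier G"
    and M: "M = generate G (H \<union> R1)" "M \<inter> R2 = {}"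
    and gen: "generate G (H \<union> (R1 \<union> R2)) = carrier G"
    and inj: "inj_on (double_coset G H) R2"
    and same: "\<And>r s. \<lbrakk> r \<in> R2; s \<in> R2; double_coset G M r = double_coset G M s \<rbrakk>
           \<Longrightarrow> generate G (H \<union> {r}) = generate G (H \<union> {s})"
  shows "card M \<le> card (coset_boundary G H (R1 \<union> R2) K) \<or>
    (separates (G\<lparr>carrier := M\<rparr>) H R1 (K \<inter> M) \<or> card (coset_boundary G H R1 (K \<inter> M)) + card H = card M) \<and>
    card (coset_boundary G H R1 (K \<inter> M)) + (\<Sum>s\<in>R2. card (double_coset G H s))
      \<le> card (coset_boundary G H (R1 \<union> R2) K)"
proof -
  let ?S = "R1 \<union> R2"
  let ?d = "coset_boundary G H ?S K"
  define L where "L = K \<inter> M"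
  define B1 where "B1 = coset_boundary G H R1 L"
  have S: "?S \<subseteq> carrier G" using R1 R2 by blast
  have Hc: "H \<subseteq> carrier G" by (rule subgroup.subset[OF subgroup_H])
  have Kc: "K \<subseteq> carrier G" by (rule subgroup.subset[OF K(1)])
  have Msub: "subgroup M G" unfolding M(1) by (rule generate_is_subgroup) (use Hc R1 in blast)
  have Mc: "M \<subseteq> carrier G" by (rule subgroup.subset[OF Msub])
  have HM: "H \<subseteq> M" and R1M: "R1 \<subseteq> M" unfolding M(1) by (auto intro: generate.incl)
  have Lsub: "subgroup L G" unfolding L_def by (rule subgroups_Inter_pair[OF K(1) Msub])
  have Lc: "L \<subseteq> carrier G" using Kc L_def by blast
  have HL: "H \<subseteq> L" using HM K L_def by blast
  have dc: "?d \<subseteq> carrier G" by (rule coset_boundary_carrier[OF Kc S])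
  have fin: "finite X" if "X \<subseteq> carrier G" for X using that by (rule finite_subset_carrier)
  have KN: "K \<union> coset_nbhd G H ?S K \<noteq> carrier G" using K(3) by (simp add: separates_def)
  have NLM: "coset_nbhd G H R1 L \<subseteq> M"
    using subgroup.m_closed[OF Msub] R1M HM by (auto simp: mem_coset_nbhd L_def subset_iff)
  have NLK: "coset_nbhd G H R1 L \<subseteq> coset_nbhd G H ?S K"
    unfolding coset_nbhd_def L_def by (intro mono_set_mult) auto
  have B1M: "B1 \<subseteq> M" and B1d: "B1 \<subseteq> ?d"
    using NLM NLK by (auto simp: B1_def coset_boundary_def L_def)
  have finB1: "finite B1" using B1M Mc fin by blast
  \<comment> \<open>\<open>B1\<close> lies in \<open>M\<close>, so any part of the boundary of
    \<open>K\<close> outside \<open>M\<close> adds to it.\<close>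
  have disj_bound: "card B1 + card Y \<le> card ?d" if "Y \<subseteq> ?d" "Y \<inter> M = {}" for Y
  proof -
    have "finite Y" using that dc fin by blast
    then have "card B1 + card Y = card (B1 \<union> Y)"
      using that B1M finB1 by (intro card_Un_disjoint[symmetric]) auto
    also have "\<dots> \<le> card ?d" using that B1d fin[OF dc] by (intro card_mono) auto
    finally show ?thesis .
  qed
  show ?thesis
  proof (cases "M \<subseteq> K")
    case True
    \<comment> \<open>Otherwise \<open>K\<close> would be the whole group and could not separate.
      Any \<open>s\<close> outside \<open>K\<close> then moves all of \<open>K\<close> into the
      boundary.\<close>
    have "\<not> ?S \<subseteq> K"
    proof
      assume "?S \<subseteq> K"
      then have "generate G (H \<union> ?S) \<subseteq> K" using K by (intro generate_subgroup_incl) auto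
      then show False using gen KN Kc coset_nbhd_carrier[OF Kc S] by blast
    qed
    then obtain s where s: "s \<in> ?S" "s \<notin> K" by blast
    have sc: "s \<in> carrier G" using s S by blast
    have "K #> s \<subseteq> ?d"
      using right_coset_subset_nbhd[OF order_refl Kc s(1) S]
        right_coset_disjoint_subgroup[OF K(1) order_refl sc s(2)]
      by (auto simp: coset_boundary_def)
    then have "card (K #> s) \<le> card ?d" using card_mono[OF fin[OF dc]] by blast
    then have "card K \<le> card ?d" using card_right_translate[OF Kc sc] by simp
    moreover have "card M \<le> card K" using card_mono[OF fin[OF Kc] True] .
    ultimately show ?thesis by linarith
  next
    case False
    have "\<not> R1 \<subseteq> K"
    proof
      assume "R1 \<subseteq> K"
      then have "M \<subseteq> K" unfolding M(1) using K by (intro generate_subgroup_incl) auto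
      then show False using False by blast
    qed
    \<comment> \<open>Right multiplication by \<open>r\<close> pushes subsets of \<open>K\<close>
      out of \<open>K\<close> and, as \<open>r\<close> is in \<open>M\<close>, keeps elements
      outside \<open>M\<close> outside it.\<close>
    then obtain r where r: "r \<in> R1" "r \<notin> K" by blast
    have rc: "r \<in> carrier G" and rM: "r \<in> M" and rS: "r \<in> ?S" using r R1 R1M by auto
    have cardM: "card B1 + card L = card M" if "L \<union> coset_nbhd G H R1 L = M"
    proof -
      have "card B1 + card L = card (B1 \<union> L)"
        using finB1 fin[OF Lc] by (intro card_Un_disjoint[symmetric]) (auto simp: B1_def coset_boundary_def)
      also have "B1 \<union> L = M" using that by (auto simp: B1_def coset_boundary_def)
      finally show ?thesis .
    qed
    \<comment> \<open>Either the boundary of \<open>L\<close> inside \<open>M\<close> is large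
      enough for the second alternative, or \<open>L\<close> differs from \<open>H\<close> and
      together with its boundary fills \<open>M\<close>.\<close>
    show ?thesis
    proof (cases "L \<union> coset_nbhd G H R1 L \<noteq> M \<or> L = H")
      case True
      \<comment> \<open>Double cosets of \<open>Ra\<close> lie in the boundary directly. Those of
        \<open>Rb\<close> lie inside \<open>K\<close> and are first translated by \<open>r\<close>,
        which preserves their size.\<close>
      define Ra where "Ra = R2 - K"
      define Rb where "Rb = R2 \<inter> K"
      define Ya where "Ya = (\<Union>s\<in>Ra. double_coset G H s)"
      define Zb where "Zb = (\<Union>s\<in>Rb. double_coset G H s)"
      have Rac: "Ra \<subseteq> carrier G" "Rb \<subseteq> carrier G" using R2 by (auto simp: Ra_def Rb_def)
      have Ya_d: "Ya \<subseteq> ?d"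
      proof -
        have "double_coset G H s \<subseteq> coset_nbhd G H ?S K" if "s \<in> Ra" for s
          unfolding double_coset_def coset_nbhd_def r_coset_eq_set_mult
          using that K(2) by (intro mono_set_mult) (auto simp: Ra_def)
        moreover have "double_coset G H s \<inter> K = {}" if "s \<in> Ra" for s
          using double_coset_disjoint_subgroup[OF K(1,2)] that R2 by (auto simp: Ra_def)
        ultimately show ?thesis by (auto simp: Ya_def coset_boundary_def)
      qed
      have YaM: "Ya \<inter> M = {}"
        using double_coset_disjoint_subgroup[OF Msub HM] Rac M(2) by (auto simp: Ya_def Ra_def)
      have ZbK: "Zb \<subseteq> K"
        using subgroup.m_closed[OF K(1)] K(2) by (auto simp: Zb_def Rb_def mem_double_coset subset_iff)
      have Zbc: "Zb \<subseteq> carrier G" using ZbK Kc by blast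
      have ZbM: "Zb \<inter> M = {}"
        using double_coset_disjoint_subgroup[OF Msub HM] Rac M(2) by (auto simp: Zb_def Rb_def)
      have Yb_d: "Zb #> r \<subseteq> ?d"
        using right_coset_subset_nbhd[OF ZbK Kc rS S] right_coset_disjoint_subgroup[OF K(1) ZbK rc r(2)]
        by (auto simp: coset_boundary_def)
      have YbM: "(Zb #> r) \<inter> M = {}"
        using mem_subgroup_cancel_right[OF Msub _ rM] ZbM Zbc by (auto simp: r_coset_def)
      \<comment> \<open>A common element \<open>z \<otimes> r\<close> lies in the
        \<open>M\<close>-double cosets of both \<open>s\<close> and \<open>t\<close>, since
        \<open>r\<close> is in \<open>M\<close>. By \<open>same\<close>, \<open>s\<close> then lies
        in the group generated by \<open>H\<close> and \<open>t\<close>, hence in \<open>K\<close>,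
        contrary to the choice of \<open>Ra\<close>.\<close>
      have disj: "Ya \<inter> (Zb #> r) = {}"
      proof (rule ccontr)
        assume "\<not> ?thesis"
        then obtain s t z where st: "s \<in> Ra" "t \<in> Rb" "z \<in> double_coset G H t" "z \<otimes> r \<in> double_coset G H s"
          by (auto simp: Ya_def Zb_def r_coset_def)
        have sub: "double_coset G H x \<subseteq> double_coset G M x" for x
          unfolding double_coset_def r_coset_eq_set_mult using HM by (intro mono_set_mult) auto
        have sc: "s \<in> carrier G" "t \<in> carrier G" using st Rac by auto
        have zc: "z \<in> carrier G" using st double_coset_carrier[OF subgroup_H] sc by blast
        have "z \<otimes> r = \<one> \<otimes> z \<otimes> r" using zc rc by simp
        then have "z \<otimes> r \<in> double_coset G M z"
          using rM subgroup.one_closed[OF Msub] unfolding mem_double_coset by blast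
        then have "double_coset G M (z \<otimes> r) = double_coset G M z"
          using double_coset_eqI[OF Msub zc] by blast
        moreover have "double_coset G M z = double_coset G M t"
          using double_coset_eqI[OF Msub sc(2)] st sub by blast
        moreover have "double_coset G M (z \<otimes> r) = double_coset G M s"
          using double_coset_eqI[OF Msub sc(1)] st sub by blast
        ultimately have "generate G (H \<union> {s}) = generate G (H \<union> {t})"
          using same[of s t] st by (simp add: Ra_def Rb_def)
        moreover have "generate G (H \<union> {t}) \<subseteq> K"
          using K st by (intro generate_subgroup_incl) (auto simp: Rb_def)
        moreover have "s \<in> generate G (H \<union> {s})" by (rule generate.incl) simp
        ultimately show False using st by (auto simp: Ra_def)
      qed
      have injs: "inj_on (double_coset G H) Ra" "inj_on (double_coset G H) Rb"
        using inj by (auto simp: Ra_def Rb_def intro: inj_on_subset)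
      have "(\<Sum>s\<in>R2. card (double_coset G H s)) =
          (\<Sum>s\<in>Ra. card (double_coset G H s)) + (\<Sum>s\<in>Rb. card (double_coset G H s))"
        using sum.Int_Diff[OF fin[OF R2], of _ K] by (simp add: Ra_def Rb_def add.commute)
      also have "\<dots> = card Ya + card (Zb #> r)"
        using card_Union_double_cosets[OF Rac(1) injs(1)] card_Union_double_cosets[OF Rac(2) injs(2)]
          card_right_translate[OF Zbc rc] by (simp add: Ya_def Zb_def)
      also have "\<dots> = card (Ya \<union> (Zb #> r))"
        using disj Ya_d Yb_d dc fin by (intro card_Un_disjoint[symmetric]) (meson subset_trans)+
      finally have "card B1 + (\<Sum>s\<in>R2. card (double_coset G H s)) \<le> card ?d"
        using disj_bound[of "Ya \<union> (Zb #> r)"] Ya_d Yb_d YaM YbM by auto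
      moreover have "separates (G\<lparr>carrier := M\<rparr>) H R1 L \<or> card B1 + card H = card M"
      proof (cases "L \<union> coset_nbhd G H R1 L = M")
        case True
        then show ?thesis using cardM \<open>L \<union> coset_nbhd G H R1 L \<noteq> M \<or> L = H\<close> by auto
      next
        case False
        have "L <#> H \<subseteq> L" using subgroup.m_closed[OF Lsub] HL by (auto simp: set_mult_def)
        moreover have "L \<noteq> {}" using subgroup.one_closed[OF Lsub] by blast
        ultimately show ?thesis using False by (simp add: separates_def coset_nbhd_def L_def)
      qed
      ultimately show ?thesis by (simp add: B1_def L_def)
    next
      case False
      then have LM: "L \<union> coset_nbhd G H R1 L = M" by simp
      \<comment> \<open>Here \<open>B1\<close> is all of \<open>M - L\<close>, so |L| further
        boundary elements outside \<open>M\<close> bring the count up to |M|.\<close>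
      have "\<exists>Y. Y \<subseteq> ?d \<and> Y \<inter> M = {} \<and> card L \<le> card Y"
      proof (cases "K \<subseteq> M")
        case True
        then have KL: "K = L" by (auto simp: L_def)
        \<comment> \<open>Without \<open>R2\<close> the group \<open>M\<close> would be everything,
          and \<open>K = L\<close> together with its neighbourhood would cover it.\<close>
        have "R2 \<noteq> {}"
        proof
          assume "R2 = {}"
          then have "M = carrier G" using M(1) gen by simp
          then show False using KN LM \<open>R2 = {}\<close> KL by simp
        qed
        then obtain s where s: "s \<in> R2" by blast
        have sc: "s \<in> carrier G" "s \<notin> M" "s \<in> ?S" using s R2 M(2) by auto
        have sM: "(K #> s) \<inter> M = {}" by (rule right_coset_disjoint_subgroup[OF Msub True sc(1,2)])
        then have "K #> s \<subseteq> ?d"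
          using right_coset_subset_nbhd[OF order_refl Kc sc(3) S] True by (auto simp: coset_boundary_def)
        then show ?thesis using sM card_right_translate[OF Kc sc(1)] KL by (intro exI[of _ "K #> s"]) simp
      next
        case False
        then obtain k where k: "k \<in> K" "k \<notin> M" by blast
        have kc: "k \<in> carrier G" using k Kc by blast
        \<comment> \<open>Left multiplication by \<open>k\<close> moves \<open>L\<close> outside
          \<open>M\<close> within \<open>K\<close>; right multiplication by \<open>r\<close> then
          moves it out of \<open>K\<close>.\<close>
        let ?Z = "(\<otimes>) k ` L"
        have ZK: "?Z \<subseteq> K" using k subgroup.m_closed[OF K(1)] by (auto simp: L_def)
        have ZM: "?Z \<inter> M = {}"
          using mem_subgroup_cancel_right[OF Msub kc] k by (auto simp: L_def)
        have Zc: "?Z \<subseteq> carrier G" using ZK Kc by blast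
        have "?Z #> r \<subseteq> ?d"
          using right_coset_subset_nbhd[OF ZK Kc rS S] right_coset_disjoint_subgroup[OF K(1) ZK rc r(2)]
          by (auto simp: coset_boundary_def)
        moreover have "(?Z #> r) \<inter> M = {}"
          using mem_subgroup_cancel_right[OF Msub _ rM] ZM Zc by (auto simp: r_coset_def)
        moreover have "card (?Z #> r) = card L"
          using card_right_translate[OF Zc rc] card_translate[OF kc Lc] by simp
        ultimately show ?thesis by (intro exI[of _ "?Z #> r"]) simp
      qed
      then obtain Y where "Y \<subseteq> ?d" "Y \<inter> M = {}" "card L \<le> card Y" by blast
      then have "card M \<le> card ?d" using disj_bound[of Y] cardM[OF LM] by linarith
      then show ?thesis by blast
    qed
  qed
qed

end

section \<open>Passing to subgroups and inverses\<close>

lemma coset_nbhd_consistent: "coset_nbhd (G\<lparr>carrier := M\<rparr>) H T A = coset_nbhd G H T A"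
  by (simp add: coset_nbhd_def)

lemma coset_boundary_consistent: "coset_boundary (G\<lparr>carrier := M\<rparr>) H T A = coset_boundary G H T A"
  by (simp add: coset_boundary_def coset_nbhd_consistent)

context finite_coset_space
begin

text \<open>Together with the next lemmas this shows that the hypotheses on \<open>R1\<close> and
  \<open>R2\<close> survive inversion, as is required when the atom lives in the reversed
  digraph.\<close>

lemma generate_inv_image:
  assumes "R \<subseteq> carrier G"
  shows "generate G (H \<union> m_inv G ` R) = generate G (H \<union> R)"
proof -
  have sub: "generate G (H \<union> m_inv G ` X) \<subseteq> generate G (H \<union> X)" if "X \<subseteq> carrier G" for X
  proof (rule generate_subgroup_incl)
    show "subgroup (generate G (H \<union> X)) G"
      using that H_carrier by (intro generate_is_subgroup) auto
    show "H \<union> m_inv G ` X \<subseteq> generate G (H \<union> X)"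
      by (auto intro: generate.incl generate.inv)
  qed
  have "m_inv G ` m_inv G ` R = R" using assms by (force simp: image_iff)
  then show ?thesis using sub[OF assms] sub[of "m_inv G ` R"] assms by auto
qed

lemma double_coset_inv:
  assumes M: "subgroup M G" and s: "s \<in> carrier G"
  shows "double_coset G M (inv s) = m_inv G ` double_coset G M s"
proof -
  have sub: "m_inv G ` double_coset G M x \<subseteq> double_coset G M (inv x)" if x: "x \<in> carrier G" for x
  proof
    fix y assume "y \<in> m_inv G ` double_coset G M x"
    then obtain h k where h: "h \<in> M" "k \<in> M" "y = inv (h \<otimes> x \<otimes> k)" by (auto simp: mem_double_coset)
    then have "y = inv k \<otimes> inv x \<otimes> inv h"
      using x subgroup.mem_carrier[OF M] by (simp add: inv_mult_group m_assoc)
    then show "y \<in> double_coset G M (inv x)"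
      using h subgroup.m_inv_closed[OF M] unfolding mem_double_coset by blast
  qed
  have "double_coset G M (inv s) \<subseteq> m_inv G ` double_coset G M s"
  proof
    fix y assume y: "y \<in> double_coset G M (inv s)"
    then have "inv y \<in> double_coset G M s" using sub[of "inv s"] s by auto
    moreover have "y \<in> carrier G" using y double_coset_carrier[OF M, of "inv s"] s by auto
    then have "y = inv (inv y)" by simp
    ultimately show "y \<in> m_inv G ` double_coset G M s" by blast
  qed
  then show ?thesis using sub[OF s] by blast
qed

lemma double_coset_inv_eq_iff:
  assumes "subgroup M G" "r \<in> carrier G" "s \<in> carrier G"
  shows "double_coset G M (inv r) = double_coset G M (inv s) \<longleftrightarrow> double_coset G M r = double_coset G M s"
  using double_coset_inv[OF assms(1)] assms(2,3) inv_closed inv_inv by metis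

lemma card_double_coset_inv:
  assumes "s \<in> carrier G"
  shows "card (double_coset G H (inv s)) = card (double_coset G H s)"
  using double_coset_inv[OF subgroup_H assms] double_coset_carrier[OF subgroup_H assms]
  by (metis card_image inj_on_subset inv_inj)

text \<open>The double coset is the neighbourhood of \<open>H\<close> under the single element
  \<open>s\<close>, hence a union of left cosets.\<close>

lemma coset_degree_mult_card:
  assumes "s \<in> carrier G"
  shows "coset_degree G H s * card H = card (double_coset G H s)"
proof -
  have "double_coset G H s = coset_nbhd G H {s} H"
    by (simp add: double_coset_def coset_nbhd_def r_coset_eq_set_mult)
  then have "double_coset G H s <#> H \<subseteq> double_coset G H s"
    using coset_nbhd_mult_H[OF subgroup.subset[OF subgroup_H], of "{s}"] assms by simp
  then show ?thesis
    unfolding coset_degree_def using card_lcosets_in double_coset_carrier[OF subgroup_H assms] by blast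
qed

end

section \<open>Comparison of the two connectivities\<close>

theorem theorem14:
  fixes G :: "('a, 'm) monoid_scheme" and H S R\<^sub>1 R\<^sub>2 G' :: "'a set"
  assumes "group G"
    and "finite (carrier G)"
    and "subgroup H G"
    and "S \<subseteq> carrier G - H"
    and "inj_on (double_coset G H) S"
    and "generate G (H \<union> S) = carrier G"
    and "\<not> is_complete (with_proj (cayley_coset_digraph G H S))"
    and "R\<^sub>1 \<union> R\<^sub>2 = S"
    and "R\<^sub>1 \<inter> R\<^sub>2 = {}"
    and "G' = generate G (H \<union> R\<^sub>1)"
    and "G' \<inter> R\<^sub>2 = {}"
    and "\<And>r s. \<lbrakk> r \<in> R\<^sub>2; s \<in> R\<^sub>2; double_coset G G' r = double_coset G G' s \<rbrakk>
           \<Longrightarrow> generate G (H \<union> {r}) = generate G (H \<union> {s})"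
  shows "vertex_connectivity (with_proj (cayley_coset_digraph G H S)) \<ge>
           min (card (verts (with_proj (cayley_coset_digraph (G\<lparr>carrier := G'\<rparr>) H R\<^sub>1))))
               (vertex_connectivity (with_proj (cayley_coset_digraph (G\<lparr>carrier := G'\<rparr>) H R\<^sub>1))
                  + (\<Sum>s\<in>R\<^sub>2. coset_degree G H s))"
proof -
  interpret group G by fact
  interpret finite_coset_space G H
    by (intro finite_coset_space.intro finite_coset_space_axioms.intro assms)
  let ?v = "vertex_connectivity (with_proj (cayley_coset_digraph G H S))"
  let ?v' = "vertex_connectivity (with_proj (cayley_coset_digraph (G\<lparr>carrier := G'\<rparr>) H R\<^sub>1))"
  let ?d = "\<Sum>s\<in>R\<^sub>2. coset_degree G H s"
  have Hc: "H \<subseteq> carrier G" by (rule subgroup.subset[OF subgroup_H])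
  have S: "S \<subseteq> carrier G" and R1: "R\<^sub>1 \<subseteq> carrier G" and R2: "R\<^sub>2 \<subseteq> carrier G"
    using assms(4,8) by auto
  have G': "subgroup G' G" unfolding assms(10) using Hc R1 by (intro generate_is_subgroup) auto
  have HG': "H \<subseteq> G'" and R1G': "R\<^sub>1 \<subseteq> G'" unfolding assms(10) by (auto intro: generate.incl)
  interpret sub: finite_coset_space "G\<lparr>carrier := G'\<rparr>" H
  proof (intro finite_coset_space.intro finite_coset_space_axioms.intro)
    show "group (G\<lparr>carrier := G'\<rparr>)" by (rule subgroup_imp_group[OF G'])
    show "finite (carrier (G\<lparr>carrier := G'\<rparr>))"
      using finite_subset_carrier[OF subgroup.subset[OF G']] by simp
    show "subgroup H (G\<lparr>carrier := G'\<rparr>)" by (rule subgroup_incl[OF assms(3) G' HG'])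
  qed
  have R1': "R\<^sub>1 \<subseteq> carrier (G\<lparr>carrier := G'\<rparr>)" using R1G' by simp
  have inv_R1: "m_inv (G\<lparr>carrier := G'\<rparr>) ` R\<^sub>1 = m_inv G ` R\<^sub>1"
    using m_inv_consistent[OF G'] R1G' by (intro image_cong) auto
  have order_G': "card (verts (with_proj (cayley_coset_digraph (G\<lparr>carrier := G'\<rparr>) H R\<^sub>1))) * card H = card G'"
    using sub.l_lagrange[OF sub.finite_carrier sub.subgroup_H]
    by (simp add: sub.pverts_cayley order_def)
  have less: "?v' * card H + card H \<le> card G'"
    using sub.vertex_connectivity_less_order[OF R1'] by simp
  \<comment> \<open>Both directions are covered, because the part of the atom inside
    \<open>G'\<close> may separate for the inverses of \<open>R\<^sub>1\<close>.\<close>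
  have le: "?v' * card H \<le> card (coset_boundary G H T A)"
    if "separates (G\<lparr>carrier := G'\<rparr>) H T A" "T = R\<^sub>1 \<or> T = m_inv G ` R\<^sub>1" for T A
    using sub.vertex_connectivity_le_boundary[OF R1', of A]
      sub.vertex_connectivity_le_boundary_inv[OF R1', of A] that
    unfolding inv_R1 coset_boundary_consistent by blast
  have degree: "?d * card H = (\<Sum>s\<in>R\<^sub>2. card (double_coset G H s))"
    unfolding sum_distrib_right using R2 by (intro sum.cong coset_degree_mult_card) auto
  obtain A where A: "separates G H S A" "card (coset_boundary G H S A) \<le> ?v * card H"
    by (rule exists_boundary_le_vertex_connectivity[OF S assms(7)])
  obtain K U where U: "U = S \<or> U = m_inv G ` S" and K: "subgroup K G" "H \<subseteq> K" "separates G H U K"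
    and min: "\<And>A. separates G H S A \<Longrightarrow> card (coset_boundary G H U K) \<le> card (coset_boundary G H S A)"
    using exists_atom_subgroup[OF S A(1)] by metis
  have small: "card (coset_boundary G H U K) \<le> ?v * card H" using min[OF A(1)] A(2) by linarith
  \<comment> \<open>\<open>T1\<close> and \<open>T2\<close> stand for the two parts of the
    partition, or for their inverses if the atom lives in the reversed digraph; from here on the
    direction no longer matters.\<close>
  obtain T1 T2 where T1: "T1 = R\<^sub>1 \<or> T1 = m_inv G ` R\<^sub>1"
    and d2: "(\<Sum>s\<in>T2. card (double_coset G H s)) = ?d * card H"
    and bound: "card G' \<le> card (coset_boundary G H U K) \<or>
      (separates (G\<lparr>carrier := G'\<rparr>) H T1 (K \<inter> G') \<or>
        card (coset_boundary G H T1 (K \<inter> G')) + card H = card G') \<and>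
      card (coset_boundary G H T1 (K \<inter> G')) + (\<Sum>s\<in>T2. card (double_coset G H s))
        \<le> card (coset_boundary G H U K)"
  proof (cases "U = S")
    case True
    then have U: "U = R\<^sub>1 \<union> R\<^sub>2" using assms(8) by simp
    have gen: "generate G (H \<union> (R\<^sub>1 \<union> R\<^sub>2)) = carrier G" using assms(6,8) by simp
    have inj: "inj_on (double_coset G H) R\<^sub>2" using assms(5,8) by (auto intro: inj_on_subset)
    show thesis
      using subgroup_boundary_bound[OF K(1,2) K(3)[unfolded U] R1 R2 assms(10,11) gen inj assms(12)]
      by (intro that[of "R\<^sub>1" "R\<^sub>2"]) (auto simp only: U degree)
  next
    case False
    let ?T1 = "m_inv G ` R\<^sub>1" and ?T2 = "m_inv G ` R\<^sub>2"
    have U: "U = ?T1 \<union> ?T2" using U False assms(8) by (auto simp: image_Un[symmetric])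
    have Tc: "?T1 \<subseteq> carrier G" "?T2 \<subseteq> carrier G" using R1 R2 by auto
    have gen': "G' = generate G (H \<union> ?T1)" using generate_inv_image[OF R1] assms(10) by simp
    have gen: "generate G (H \<union> (?T1 \<union> ?T2)) = carrier G"
      using generate_inv_image[OF S] assms(6,8) by (simp add: image_Un[symmetric])
    have disj: "G' \<inter> ?T2 = {}"
    proof (rule ccontr)
      assume "\<not> ?thesis"
      then obtain s where s: "s \<in> R\<^sub>2" "inv\<^bsub>G\<^esub> s \<in> G'" by blast
      then have "inv\<^bsub>G\<^esub> (inv\<^bsub>G\<^esub> s) \<in> G'" using subgroup.m_inv_closed[OF G'] by blast
      moreover have "s \<in> carrier G" using s R2 by blast
      ultimately have "s \<in> G'" by simp
      then show False using s assms(11) by blast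
    qed
    have inj: "inj_on (double_coset G H) ?T2"
    proof (rule inj_onI)
      fix x y assume "x \<in> ?T2" "y \<in> ?T2" and e: "double_coset G H x = double_coset G H y"
      then obtain r s where rs: "r \<in> R\<^sub>2" "s \<in> R\<^sub>2" "x = inv\<^bsub>G\<^esub> r" "y = inv\<^bsub>G\<^esub> s" by blast
      then have "double_coset G H r = double_coset G H s"
        using e double_coset_inv_eq_iff[OF subgroup_H] R2 by blast
      then have "r = s" using rs assms(5,8) by (auto dest: inj_onD)
      then show "x = y" using rs by simp
    qed
    have same: "generate G (H \<union> {x}) = generate G (H \<union> {y})"
      if xy: "x \<in> ?T2" "y \<in> ?T2" "double_coset G G' x = double_coset G G' y" for x y
    proof -
      obtain r s where rs: "r \<in> R\<^sub>2" "s \<in> R\<^sub>2" "x = inv\<^bsub>G\<^esub> r" "y = inv\<^bsub>G\<^esub> s" using xy by blast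
      then have "double_coset G G' r = double_coset G G' s"
        using xy(3) double_coset_inv_eq_iff[OF G'] R2 by blast
      then have "generate G (H \<union> {r}) = generate G (H \<union> {s})" using assms(12) rs by blast
      then show ?thesis using generate_inv_image[of "{r}"] generate_inv_image[of "{s}"] rs R2 by auto
    qed
    have "(\<Sum>s\<in>?T2. card (double_coset G H s)) = ?d * card H"
    proof -
      have "inj_on (m_inv G) R\<^sub>2" using inv_inj R2 inj_on_subset by blast
      then have "(\<Sum>s\<in>?T2. card (double_coset G H s)) = (\<Sum>s\<in>R\<^sub>2. card (double_coset G H (inv\<^bsub>G\<^esub> s)))"
        by (simp add: sum.reindex)
      also have "\<dots> = (\<Sum>s\<in>R\<^sub>2. card (double_coset G H s))"
        using R2 by (intro sum.cong card_double_coset_inv) auto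
      finally show ?thesis using degree by simp
    qed
    then show thesis
      using subgroup_boundary_bound[OF K(1,2) K(3)[unfolded U] Tc gen' disj gen inj same]
      by (intro that[of ?T1 ?T2]) (auto simp only: U)
  qed
  let ?m = "card (verts (with_proj (cayley_coset_digraph (G\<lparr>carrier := G'\<rparr>) H R\<^sub>1)))"
  \<comment> \<open>The two terms of the minimum, both scaled by |H|, which is positive and cancels
    at the end.\<close>
  have "?m * card H \<le> ?v * card H \<or> (?v' + ?d) * card H \<le> ?v * card H"
  proof (cases "card G' \<le> card (coset_boundary G H U K)")
    case True
    then show ?thesis using order_G' small by linarith
  next
    case False
    \<comment> \<open>If \<open>K \<inter> G'\<close> separates, this is \<open>le\<close>;
      otherwise its boundary has |G'| - |H| elements and \<open>less\<close> applies.\<close>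
    then have "?v' * card H \<le> card (coset_boundary G H T1 (K \<inter> G'))"
      using bound le[OF _ T1, of "K \<inter> G'"] less by linarith
    then have "?v' * card H + ?d * card H \<le> ?v * card H"
      using bound False small d2 by linarith
    then show ?thesis by (simp add: add_mult_distrib)
  qed
  then show ?thesis using card_H_pos by (auto simp: min_le_iff_disj)
qed

end
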